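(* Let $c>0$. If $X_{\theta_2(c)}$ and $X_{\theta_3(c)}$ are independent random variables that are $\theta_2(c)$-distributed and $\theta_3(c)$-distributed, respectively, then $$X_{\theta_2(c)}+X_{\theta_3(c)}\stackrel{(d)}{=}X_{\theta_2(c/2)},$$ where $X_{\theta_2(c/2)}$ is a $\theta_2(c/2)$-distributed random variable and $\stackrel{(d)}{=}$ denotes equality in distribution.
   Context: For $c>0$, the discrete Gaussian $\theta_2$-distribution with lattice parameter $\imath c$ (written $\theta_2(c)$) is the law on $\mathbb{Z}$ given by $\mathbb{P}\{X=n\}=e^{-c\pi(n+\frac12)^2}/\theta_2(0,e^{-c\pi})$, where $\theta_2(0,q)=\sum_{n\in\mathbb{Z}}q^{(n+\frac12)^2}$. The discrete Gaussian $\theta_3$-distribution with lattice parameter $\imath c$ (written $\theta_3(c)$) is the law on $\mathbb{Z}$ given by $\mathbb{P}\{X=n\}=e^{-c\pi n^2}/\theta_3(0,e^{-c\pi})$, where $\theta_3(0,q)=\sum_{n\in\mathbb{Z}}q^{n^2}$. *)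

theory Defs
  imports "HOL-Probability.Probability"
begin

text \<open>The theta constants at \<open>z = 0\<close>, for a real nome \<open>q\<close> with \<open>0 < q < 1\<close>.\<close>

definition theta2_zero :: "real \<Rightarrow> real" where
  "theta2_zero q = (\<Sum>\<^sub>\<infinity>n::int. q powr ((of_int n + 1/2)\<^sup>2))"

definition theta3_zero :: "real \<Rightarrow> real" where
  "theta3_zero q = (\<Sum>\<^sub>\<infinity>n::int. q powr ((of_int n)\<^sup>2))"

definition theta2_mass :: "real \<Rightarrow> int \<Rightarrow> real" where
  "theta2_mass c n = exp (- c * pi * (of_int n + 1/2)\<^sup>2) / theta2_zero (exp (- c * pi))"

definition theta3_mass :: "real \<Rightarrow> int \<Rightarrow> real" where
  "theta3_mass c n = exp (- c * pi * (of_int n)\<^sup>2) / theta3_zero (exp (- c * pi))"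

text \<open>A random variable with values in the discrete space \<open>\<int>\<close> has the given law iff it has
  the mass function as density with respect to counting measure.\<close>

definition theta2_distributed :: "'a measure \<Rightarrow> real \<Rightarrow> ('a \<Rightarrow> int) \<Rightarrow> bool" where
  "theta2_distributed M c X \<longleftrightarrow>
     distributed M (count_space UNIV) X (\<lambda>n. ennreal (theta2_mass c n))"

definition theta3_distributed :: "'a measure \<Rightarrow> real \<Rightarrow> ('a \<Rightarrow> int) \<Rightarrow> bool" where
  "theta3_distributed M c X \<longleftrightarrow>
     distributed M (count_space UNIV) X (\<lambda>n. ennreal (theta3_mass c n))"

end

theory Submission
  imports Defs
begin

text \<open>Since \<open>(k + 1/2)\<^sup>2 + (n - k)\<^sup>2 = ((n + 1/2)\<^sup>2 + (2k - n + 1/2)\<^sup>2) / 2\<close>, the law of the sum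
  at \<open>n\<close> is \<open>exp (- (c/2) \<pi> (n + 1/2)\<^sup>2)\<close> times a sum of the same weight over all \<open>j\<close> with the parity
  of \<open>n\<close>. The reflection \<open>j \<mapsto> -1 - j\<close> swaps the parities and preserves the weight, so this factor
  does not depend on \<open>n\<close>. Two probability laws proportional to the same weight coincide, so
  neither convergence nor the values of the theta constants matter.\<close>

text \<open>The sign lets products of masses pass through \<open>ennreal\<close>. It holds for every
  \<open>q\<close>, since \<open>infsum\<close> is 0 on a family that is not summable.\<close>

lemma theta2_zero_nonneg: "theta2_zero q \<ge> 0"
  unfolding theta2_zero_def by (intro infsum_nonneg) simp

lemma theta3_zero_nonneg: "theta3_zero q \<ge> 0"
  unfolding theta3_zero_def by (intro infsum_nonneg) simp

lemma distributed_count_space_emeasure_singleton: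
  assumes "distributed M (count_space UNIV) X f"
  shows "emeasure M (X -` {a} \<inter> space M) = f a"
  by (subst distributed_emeasure[OF assms]) simp_all

text \<open>Convolution formula: the event splits into the countably many disjoint events
  \<open>X = k\<close>, \<open>Y = n - k\<close>, and independence factors each of them.\<close>

lemma (in prob_space) indep_var_emeasure_add_eq:
  fixes X Y :: "'a \<Rightarrow> int"
  assumes indep: "indep_var (count_space UNIV) X (count_space UNIV) Y"
  shows "emeasure M ((\<lambda>\<omega>. X \<omega> + Y \<omega>) -` {n} \<inter> space M) =
    (\<integral>\<^sup>+k. emeasure M (X -` {k} \<inter> space M) * emeasure M (Y -` {n - k} \<inter> space M)
      \<partial>count_space UNIV)"
proof -
  have [measurable]: "X \<in> measurable M (count_space UNIV)" "Y \<in> measurable M (count_space UNIV)"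
    using indep by (auto dest: indep_var_rv1 indep_var_rv2)
  let ?A = "\<lambda>k. (X -` {k} \<inter> space M) \<inter> (Y -` {n - k} \<inter> space M)"
  have factor: "emeasure M (?A k) =
      emeasure M (X -` {k} \<inter> space M) * emeasure M (Y -` {n - k} \<inter> space M)" for k
  proof -
    have "?A k = (\<lambda>\<omega>. (X \<omega>, Y \<omega>)) -` ({k} \<times> {n - k}) \<inter> space M"
      by auto
    moreover have "prob \<dots> =
        prob (X -` {k} \<inter> space M) * prob (Y -` {n - k} \<inter> space M)"
      by (rule indep_varD[OF indep]) auto
    ultimately show ?thesis
      by (simp add: emeasure_eq_measure ennreal_mult)
  qed
  have "(\<lambda>\<omega>. X \<omega> + Y \<omega>) -` {n} \<inter> space M = (\<Union>k. ?A k)"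
    by auto
  also have "emeasure M \<dots> = (\<integral>\<^sup>+k. emeasure M (?A k) \<partial>count_space UNIV)"
    by (rule emeasure_UN_countable) (auto simp: disjoint_family_on_def)
  finally show ?thesis
    by (simp only: factor)
qed

text \<open>The arguments \<open>2 * k - n\<close> run once through the integers with the parity of
  \<open>n\<close>; the even class serves as reference. Values in \<open>ennreal\<close> make every
  reindexing legitimate.\<close>

lemma nn_integral_parity_class_eq:
  fixes g :: "int \<Rightarrow> ennreal"
  assumes refl: "\<And>j. g (- 1 - j) = g j"
  shows "(\<integral>\<^sup>+k. g (2 * k - n) \<partial>count_space UNIV) = (\<integral>\<^sup>+k. g (2 * k) \<partial>count_space UNIV)"
proof (cases "even n")
  case True
  then obtain m where n: "n = 2 * m" by blast
  have "bij (\<lambda>k::int. k + m)"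
    by (rule bij_betw_byWitness[where f' = "\<lambda>k. k - m"]) auto
  from nn_integral_bij_count_space[OF this, of "\<lambda>k. g (2 * k - n)"] show ?thesis
    by (simp add: n algebra_simps)
next
  case False
  then obtain m where n: "n = 2 * m + 1" by (elim oddE)
  \<comment> \<open>Replacing \<open>k\<close> by \<open>m - k\<close> turns
    \<open>2 * k - n\<close> into \<open>- 1 - 2 * k\<close>, the mirror image of the even number
    \<open>2 * k\<close>.\<close>
  have "bij (\<lambda>k::int. m - k)"
    by (rule bij_betw_byWitness[where f' = "\<lambda>k. m - k"]) auto
  from nn_integral_bij_count_space[OF this, of "\<lambda>k. g (2 * k - n)"]
  have "(\<integral>\<^sup>+k. g (2 * k - n) \<partial>count_space UNIV) = (\<integral>\<^sup>+k. g (- 1 - 2 * k) \<partial>count_space UNIV)"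
    by (simp add: n algebra_simps)
  then show ?thesis by (simp add: refl)
qed

text \<open>Total mass 1 makes both constants inverse to the total weight, so they agree.\<close>

lemma prob_space_eqI_proportional:
  fixes P Q :: "'a::countable measure"
  assumes "prob_space P" "prob_space Q"
    and sets: "sets P = UNIV" "sets Q = UNIV"
    and P: "\<And>n. emeasure P {n} = K * w n" and Q: "\<And>n. emeasure Q {n} = L * w n"
  shows "P = Q"
proof -
  have total: "C * (\<integral>\<^sup>+n. w n \<partial>count_space UNIV) = 1"
    if "prob_space R" "sets R = UNIV" "\<And>n. emeasure R {n} = C * w n"
    for R :: "'a measure" and C :: ennreal
  proof -
    have sp: "space R = UNIV"
      using sets_eq_imp_space_eq[of R "count_space UNIV"] that(2) by simp
    have "1 = emeasure R UNIV"
      using prob_space.emeasure_space_1[OF that(1)] sp by simp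
    also have "\<dots> = (\<integral>\<^sup>+n. emeasure R {n} \<partial>count_space UNIV)"
      by (rule emeasure_countable_singleton) (auto simp: that(2))
    finally show ?thesis
      by (simp add: that(3) nn_integral_cmult)
  qed
  have KW: "K * (\<integral>\<^sup>+n. w n \<partial>count_space UNIV) = 1"
    by (rule total[OF assms(1) sets(1) P])
  have LW: "L * (\<integral>\<^sup>+n. w n \<partial>count_space UNIV) = 1"
    by (rule total[OF assms(2) sets(2) Q])
  \<comment> \<open>With W the total weight, K = K(LW) = L(KW) = L, which avoids division in
    \<open>ennreal\<close>.\<close>
  have "K = L"
    by (metis KW LW mult.assoc mult.commute mult_1_right)
  then show ?thesis
    by (intro measure_eqI_countable[of _ UNIV]) (auto simp: sets P Q)
qed

theorem theorem7p20:
  fixes c :: real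
    and M :: "'a measure" and N :: "'b measure"
    and X Y :: "'a \<Rightarrow> int" and Z :: "'b \<Rightarrow> int"
  assumes "c > 0"
    and "prob_space M" and "prob_space N"
    and "theta2_distributed M c X"
    and "theta3_distributed M c Y"
    and "prob_space.indep_var M (count_space UNIV) X (count_space UNIV) Y"
    and "theta2_distributed N (c / 2) Z"
  shows "distr M (count_space UNIV) (\<lambda>\<omega>. X \<omega> + Y \<omega>) = distr N (count_space UNIV) Z"
proof -
  interpret M: prob_space M by fact
  interpret N: prob_space N by fact
  note X = assms(4)[unfolded theta2_distributed_def]
  note Y = assms(5)[unfolded theta3_distributed_def]
  note Z = assms(7)[unfolded theta2_distributed_def]
  have [measurable]: "X \<in> measurable M (count_space UNIV)" "Y \<in> measurable M (count_space UNIV)"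
      "Z \<in> measurable N (count_space UNIV)"
    using X Y Z by (auto simp: distributed_def)
  \<comment> \<open>\<open>w\<close> is the unnormalised mass of \<open>Z\<close>, \<open>A\<close>
    the joint normalisation of \<open>X\<close> and \<open>Y\<close>, and \<open>S\<close> the
    weight of the even class.\<close>
  define w where "w n = ennreal (exp (- (c / 2) * pi * (of_int n + 1/2)\<^sup>2))" for n :: int
  define A where
    "A = ennreal (1 / (theta2_zero (exp (- c * pi)) * theta3_zero (exp (- c * pi))))"
  define S where "S = (\<integral>\<^sup>+k. w (2 * k) \<partial>count_space UNIV)"
  have w_refl: "w (- 1 - j) = w j" for j
    by (simp add: w_def power2_eq_square algebra_simps)
  have mass: "ennreal (theta2_mass c k) * ennreal (theta3_mass c (n - k)) =
      A * w n * w (2 * k - n)" for k n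
  proof -
    \<comment> \<open>Parallelogram identity for a = k + 1/2 and b = n - k, where a + b = n + 1/2
      and a - b = (2k - n) + 1/2; its factor 1/2 is what halves \<open>c\<close>.\<close>
    have "exp (- c * pi * (of_int k + 1/2)\<^sup>2) * exp (- c * pi * (of_int (n - k))\<^sup>2) =
        exp (- (c / 2) * pi * (of_int n + 1/2)\<^sup>2) *
        exp (- (c / 2) * pi * (of_int (2 * k - n) + 1/2)\<^sup>2)"
      unfolding exp_add[symmetric]
      by (rule arg_cong[of _ _ exp]) (simp add: power2_eq_square field_simps)
    then have "theta2_mass c k * theta3_mass c (n - k) =
        1 / (theta2_zero (exp (- c * pi)) * theta3_zero (exp (- c * pi))) *
        exp (- (c / 2) * pi * (of_int n + 1/2)\<^sup>2) *
        exp (- (c / 2) * pi * (of_int (2 * k - n) + 1/2)\<^sup>2)"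
      by (simp add: theta2_mass_def theta3_mass_def)
    then show ?thesis
      by (simp add: A_def w_def ennreal_mult[symmetric] theta2_zero_nonneg theta3_zero_nonneg
          theta2_mass_def theta3_mass_def)
  qed
  have "emeasure (distr M (count_space UNIV) (\<lambda>\<omega>. X \<omega> + Y \<omega>)) {n} = (A * S) * w n" for n
  proof -
    have "emeasure (distr M (count_space UNIV) (\<lambda>\<omega>. X \<omega> + Y \<omega>)) {n} =
        (\<integral>\<^sup>+k. A * w n * w (2 * k - n) \<partial>count_space UNIV)"
      by (simp add: emeasure_distr M.indep_var_emeasure_add_eq[OF assms(6)] mass
          distributed_count_space_emeasure_singleton[OF X]
          distributed_count_space_emeasure_singleton[OF Y])
    also have "\<dots> = A * w n * S"
      by (simp add: nn_integral_cmult nn_integral_parity_class_eq[of w, OF w_refl] S_def)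
    finally show ?thesis by (simp add: ac_simps)
  qed
  moreover have "emeasure (distr N (count_space UNIV) Z) {n} =
      ennreal (1 / theta2_zero (exp (- (c / 2) * pi))) * w n" for n
    by (simp add: emeasure_distr distributed_count_space_emeasure_singleton[OF Z] w_def
        theta2_mass_def ennreal_mult[symmetric] theta2_zero_nonneg)
  moreover have "prob_space (distr M (count_space UNIV) (\<lambda>\<omega>. X \<omega> + Y \<omega>))"
    by (rule M.prob_space_distr) measurable
  moreover have "prob_space (distr N (count_space UNIV) Z)"
    by (rule N.prob_space_distr) measurable
  \<comment> \<open>The constants compared are \<open>A * S\<close> and the reciprocal of the theta
    constant for \<open>c / 2\<close>; their equality comes out of normalisation, without evaluating
    \<open>S\<close>.\<close>
  ultimately show ?thesis
    by (intro prob_space_eqI_proportional[where w = w]) simp_all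
qed

end
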